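(* Consider a coplanar free double linkage with masses $m_x,m_y,m_z$ and rod lengths $l_1,l_2$, with total kinetic energy $K$ and total angular momentum $\mathbf L$. Put $M:=m_x+m_y+m_z$ (total mass) and $\tilde m_z:=m_z+m_y$. Then the curve traced by the node $\mathbf x$, as viewed from the center of mass, is given by the algebraic pedal equation $$\Bigl(|\mathbf L|^2-2L_1(r^2)\,K\,r^2\Bigr)\Bigl(L_1(r^2)\frac{p\,\beta}{p_c}+L_2(r^2)\Bigr)^2+|\mathbf L|^2P_2(r^2)=0,$$ where $$L_1(r^2):=\frac{M}{4\tilde m_zm_z}\Bigl(b+\frac{a}{r^2}\Bigr),\qquad L_2(r^2):=\frac{aM^2m_y}{8m_z^2\tilde m_z^2r^2}\Bigl(1+\frac{r_0r_1}{r^2}\Bigr),$$ $$P_2(r^2):=4\frac{m_x^2M^2}{\tilde m_z^2}\beta^2+\frac{m_y^3m_xM^5}{4m_z^3\tilde m_z^4}\,\frac{(r_1^2-r_0^2)^2}{r^4},$$ $$a:=Mm_y(r_1-r_0)^2,\qquad b:=4m_xm_z,$$ $$r_1:=\frac{l_1\tilde m_z+l_2m_z}{M},\qquad r_0:=\frac{l_1\tilde m_z-l_2m_z}{M},$$ $$\beta:=\frac{m_yM}{2m_z\tilde m_zr^2}\sqrt{(r_1^2-r^2)(r^2-r_0^2)}.$$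
   Context: Free double linkage: three point masses $m_x,m_y,m_z$ at positions $\mathbf x(t),\mathbf y(t),\mathbf z(t)$, with $\mathbf y$ the central node joined to $\mathbf x$ and to $\mathbf z$ by massless rigid rods, and with no outside forces. The equations of motion are $$m_x\ddot{\mathbf x}=F_1(\mathbf y-\mathbf x),\quad m_y\ddot{\mathbf y}=-F_1(\mathbf y-\mathbf x)+F_2(\mathbf z-\mathbf y),\quad m_z\ddot{\mathbf z}=-F_2(\mathbf z-\mathbf y),$$ where the internal (scalar) forces $F_1,F_2$ are such that $|\mathbf x-\mathbf y|=l_1$ and $|\mathbf z-\mathbf y|=l_2$ at all times. "Coplanar" means that the movement of the whole system (all positions and velocities) is confined to one plane. "As viewed from the center of mass" means that one uses the inertial frame in which $m_x\mathbf x+m_y\mathbf y+m_z\mathbf z=0$ at all times. The total kinetic energy $K=\frac12(m_x|\dot{\mathbf x}|^2+m_y|\dot{\mathbf y}|^2+m_z|\dot{\mathbf z}|^2)$ and the total angular momentum $\mathbf L=m_x\mathbf x\times\dot{\mathbf x}+m_y\mathbf y\times\dot{\mathbf y}+m_z\mathbf z\times\dot{\mathbf z}$, both computed in this frame, are constants of motion. Pedal coordinates of the curve $\mathbf x(t)$ with respect to the origin (the center of mass): with $$\mathbf x^\perp:=\frac{(\mathbf x\times\dot{\mathbf x})\times\mathbf x}{|\mathbf x\times\dot{\mathbf x}|}$$ (a vector in the plane of motion, perpendicular to $\mathbf x$ and of the same length), set $$r=|\mathbf x|,\qquad p=\frac{\mathbf x^\perp\cdot\dot{\mathbf x}}{|\dot{\mathbf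 x}|},\qquad p_c=\frac{\mathbf x\cdot\dot{\mathbf x}}{|\dot{\mathbf x}|}.$$ Here $r$ is the distance of the point from the origin, $p$ the distance of the tangent from the origin, $p_c$ the oriented distance of the normal from the origin, and $p^2+p_c^2=r^2$. A pedal equation of a curve is an equation satisfied by $r,p,p_c$ along the curve. The geometry of the linkage forces $r_0^2\le r^2\le r_1^2$.
   Formalization: The printed equation fails (e.g. unit masses and rods); the formal one replaces P_2 by P_2/4 in the last term and multiplies β in the pβ/p_c term by the sign of z·x^⊥, since the nonnegative root alone fails for half the configurations. It is asserted where p_c ≠ 0. *)

theory Defs
  imports "HOL-Analysis.Analysis"
begin

abbreviation velocity :: "(real \<Rightarrow> real^3) \<Rightarrow> real \<Rightarrow> real^3" where
  "velocity f t \<equiv> vector_derivative f (at t)"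

abbreviation acceleration :: "(real \<Rightarrow> real^3) \<Rightarrow> real \<Rightarrow> real^3" where
  "acceleration f \<equiv> velocity (velocity f)"

definition twice_differentiable_motion :: "real set \<Rightarrow> (real \<Rightarrow> real^3) \<Rightarrow> bool" where
  "twice_differentiable_motion T f \<longleftrightarrow>
     (\<forall>t\<in>T. f differentiable (at t) \<and> velocity f differentiable (at t))"

text \<open>The node \<open>y\<close> is the central one. No regularity is imposed on the internal
  forces \<open>F1\<close>, \<open>F2\<close> as functions of time.\<close>

definition free_double_linkage ::
  "real set \<Rightarrow> real \<Rightarrow> real \<Rightarrow> real \<Rightarrow> real \<Rightarrow> real \<Rightarrow>
   (real \<Rightarrow> real^3) \<Rightarrow> (real \<Rightarrow> real^3) \<Rightarrow> (real \<Rightarrow> real^3) \<Rightarrow> bool" where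
  "free_double_linkage T mx my mz l1 l2 x y z \<longleftrightarrow>
     mx > 0 \<and> my > 0 \<and> mz > 0 \<and> l1 > 0 \<and> l2 > 0 \<and>
     twice_differentiable_motion T x \<and>
     twice_differentiable_motion T y \<and>
     twice_differentiable_motion T z \<and>
     (\<forall>t\<in>T. norm (x t - y t) = l1 \<and> norm (z t - y t) = l2) \<and>
     (\<exists>F1 F2 :: real \<Rightarrow> real. \<forall>t\<in>T.
        mx *\<^sub>R acceleration x t = F1 t *\<^sub>R (y t - x t) \<and>
        my *\<^sub>R acceleration y t = - F1 t *\<^sub>R (y t - x t) + F2 t *\<^sub>R (z t - y t) \<and>
        mz *\<^sub>R acceleration z t = - F2 t *\<^sub>R (z t - y t))"

definition coplanar_motion ::
  "real set \<Rightarrow> (real \<Rightarrow> real^3) \<Rightarrow> (real \<Rightarrow> real^3) \<Rightarrow> (real \<Rightarrow> real^3) \<Rightarrow> bool" where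
  "coplanar_motion T x y z \<longleftrightarrow>
     (\<exists>n c. n \<noteq> 0 \<and> (\<forall>t\<in>T. \<forall>f\<in>{x, y, z}. n \<bullet> f t = c \<and> n \<bullet> velocity f t = 0))"

definition center_of_mass_frame ::
  "real set \<Rightarrow> real \<Rightarrow> real \<Rightarrow> real \<Rightarrow>
   (real \<Rightarrow> real^3) \<Rightarrow> (real \<Rightarrow> real^3) \<Rightarrow> (real \<Rightarrow> real^3) \<Rightarrow> bool" where
  "center_of_mass_frame T mx my mz x y z \<longleftrightarrow>
     (\<forall>t\<in>T. mx *\<^sub>R x t + my *\<^sub>R y t + mz *\<^sub>R z t = 0)"

definition kinetic_energy ::
  "real \<Rightarrow> real \<Rightarrow> real \<Rightarrow>
   (real \<Rightarrow> real^3) \<Rightarrow> (real \<Rightarrow> real^3) \<Rightarrow> (real \<Rightarrow> real^3) \<Rightarrow> real \<Rightarrow> real" where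
  "kinetic_energy mx my mz x y z t =
     (mx * (norm (velocity x t))\<^sup>2 + my * (norm (velocity y t))\<^sup>2
        + mz * (norm (velocity z t))\<^sup>2) / 2"

definition angular_momentum ::
  "real \<Rightarrow> real \<Rightarrow> real \<Rightarrow>
   (real \<Rightarrow> real^3) \<Rightarrow> (real \<Rightarrow> real^3) \<Rightarrow> (real \<Rightarrow> real^3) \<Rightarrow> real \<Rightarrow> real^3" where
  "angular_momentum mx my mz x y z t =
     mx *\<^sub>R cross3 (x t) (velocity x t) + my *\<^sub>R cross3 (y t) (velocity y t)
       + mz *\<^sub>R cross3 (z t) (velocity z t)"

text \<open>Pedal coordinates with respect to the origin. Where \<open>x\<close> and its velocity are parallel,
  \<open>perp\<close> is mathematically undefined; here it is then \<open>0\<close>, so that \<open>pedal_p\<close> is \<open>0\<close>,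
  which is the distance from the origin of a tangent through the origin.\<close>

definition perp :: "(real \<Rightarrow> real^3) \<Rightarrow> real \<Rightarrow> real^3" where
  "perp x t = (1 / norm (cross3 (x t) (velocity x t))) *\<^sub>R
                cross3 (cross3 (x t) (velocity x t)) (x t)"

definition pedal_r :: "(real \<Rightarrow> real^3) \<Rightarrow> real \<Rightarrow> real" where
  "pedal_r x t = norm (x t)"

definition pedal_p :: "(real \<Rightarrow> real^3) \<Rightarrow> real \<Rightarrow> real" where
  "pedal_p x t = (perp x t \<bullet> velocity x t) / norm (velocity x t)"

definition pedal_pc :: "(real \<Rightarrow> real^3) \<Rightarrow> real \<Rightarrow> real" where
  "pedal_pc x t = (x t \<bullet> velocity x t) / norm (velocity x t)"

text \<open>The sign with which the square root in \<open>\<beta>\<close> has to be taken: in the orthogonal basis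
  \<open>x\<close>, \<open>perp\<close> of the plane of motion one has
  \<open>z = \<alpha> x + \<beta> perp\<close>, where the rod lengths determine \<open>\<beta>\<close> only up to sign.\<close>

definition branch :: "(real \<Rightarrow> real^3) \<Rightarrow> (real \<Rightarrow> real^3) \<Rightarrow> real \<Rightarrow> real" where
  "branch x z t = sgn (z t \<bullet> perp x t)"

end

theory Submission
  imports Defs
begin

text \<open>In the plane of motion, with unit normal \<open>n\<close>, each rod vector \<open>q\<close> rotates:
  \<open>q' = \<omega> n \<times> q\<close>. In the frame of the center of mass all scalar quantities are then polynomials
  in the angle between the rods, which is a function of \<open>r\<^sup>2\<close>, and in the two angular velocities.
  The conserved \<open>L\<close> and \<open>2 K\<close> are a linear and a quadratic form in the angular velocities;
  eliminating these, with \<open>p / p\<^sub>c\<close> as the remaining ratio, gives the pedal equation.\<close>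

section \<open>Plane vectors as seen from a unit normal\<close>

lemma inner_cross3_cross3:
  fixes a b c d :: "real^3"
  shows "cross3 a b \<bullet> cross3 c d = (a \<bullet> c) * (b \<bullet> d) - (a \<bullet> d) * (b \<bullet> c)"
  by (simp add: cross3_simps)

lemma inner_cross3_swap:
  fixes a b c :: "real^3"
  shows "a \<bullet> cross3 n b = - (cross3 n a \<bullet> b)"
  by (simp add: cross3_simps)

lemma inner_cross3_left:
  fixes a b n :: "real^3"
  shows "n \<bullet> cross3 a b = cross3 n a \<bullet> b"
  by (simp add: cross3_simps)

lemma cross3_cross3_left:
  fixes a b c :: "real^3"
  shows "cross3 a (cross3 b c) = (a \<bullet> c) *\<^sub>R b - (a \<bullet> b) *\<^sub>R c"
  by (simp add: cross3_simps forall_3)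

text \<open>Applying \<open>cross3 n\<close> to the product gives \<open>0\<close>; applying it
  again and expanding the triple product shows that only the component along \<open>n\<close>
  remains. The coefficient is the oriented area spanned by \<open>a\<close> and \<open>b\<close> in
  the plane.\<close>

lemma cross3_plane:
  fixes n a b :: "real^3"
  assumes "norm n = 1" and "n \<bullet> a = 0" and "n \<bullet> b = 0"
  shows "cross3 a b = (cross3 n a \<bullet> b) *\<^sub>R n"
proof -
  have "cross3 n (cross3 a b) = 0"
    using assms by (simp add: cross3_cross3_left)
  then have "cross3 n (cross3 n (cross3 a b)) = 0"
    by simp
  moreover have "n \<bullet> n = 1"
    using assms(1) by (simp add: norm_eq_1)
  ultimately show ?thesis
    by (simp add: cross3_cross3_left[of n n] inner_cross3_left)
qed

text \<open>Within the plane, the vectors orthogonal to \<open>q\<close> form the line through its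
  quarter turn \<open>cross3 n q\<close>. For a rod \<open>q\<close> with relative velocity
  \<open>v\<close>, the scalar \<open>\<omega>\<close> is the angular velocity of the rod.\<close>

lemma plane_orthogonal_eq_cross3:
  fixes n q v :: "real^3"
  assumes "norm n = 1" and "n \<bullet> q = 0" and "n \<bullet> v = 0" and "q \<bullet> v = 0" and "q \<noteq> 0"
  obtains \<omega> where "v = \<omega> *\<^sub>R cross3 n q"
proof -
  have "cross3 v (cross3 n q) = 0"
    using assms by (simp add: cross3_cross3_left inner_commute)
  then have "cross3 (cross3 n q) (cross3 (cross3 n q) v) = 0"
    by (metis cross_skew cross_zero_right minus_zero)
  then have *: "(cross3 n q \<bullet> cross3 n q) *\<^sub>R v = (cross3 n q \<bullet> v) *\<^sub>R cross3 n q"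
    by (simp add: cross3_cross3_left)
  have "n \<bullet> n = 1"
    using assms(1) by (simp add: norm_eq_1)
  then have "cross3 n q \<bullet> cross3 n q = q \<bullet> q"
    using assms by (simp add: inner_cross3_cross3)
  with * \<open>q \<noteq> 0\<close> have "((cross3 n q \<bullet> v) / (q \<bullet> q)) *\<^sub>R cross3 n q = v"
    by (simp add: vector_fraction_eq_iff)
  then show thesis
    using that by metis
qed

section \<open>Conservation laws\<close>

lemma bounded_bilinear_cross3: "bounded_bilinear cross3"
  using bilinear_cross bilinear_conv_bounded_bilinear by blast

lemmas has_vector_derivative_inner =
  bounded_bilinear.has_vector_derivative[OF bounded_bilinear_inner]

lemmas has_vector_derivative_cross3 =
  bounded_bilinear.has_vector_derivative[OF bounded_bilinear_cross3]

lemmas has_vector_derivative_scaleR_right =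
  bounded_linear.has_vector_derivative[OF bounded_linear_scaleR_right]

lemma vector_derivative_const_on_open:
  fixes f :: "real \<Rightarrow> 'a::real_normed_vector"
  assumes "(f has_vector_derivative f') (at t)" "open S" "t \<in> S" "\<And>s. s \<in> S \<Longrightarrow> f s = c"
  shows "f' = 0"
proof -
  have "((\<lambda>_. c) has_vector_derivative f') (at t)"
    using has_vector_derivative_transform_within_open[OF assms(1-3)] assms(4) by simp
  then show ?thesis
    using vector_derivative_unique_at has_vector_derivative_const by blast
qed

lemma constant_on_open_interval:
  fixes f :: "real \<Rightarrow> 'a::real_normed_vector"
  assumes "open T" "is_interval T" "\<And>s. s \<in> T \<Longrightarrow> (f has_vector_derivative 0) (at s)"
    and "t0 \<in> T" "t \<in> T"
  shows "f t = f t0"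
proof -
  have "convex T"
    using assms(2) by (simp add: is_interval_convex)
  moreover have "(f has_vector_derivative 0) (at s within T)" if "s \<in> T" for s
    using assms(3)[OF that] has_vector_derivative_at_within by blast
  ultimately obtain c where "\<And>s. s \<in> T \<Longrightarrow> f s = c"
    using has_vector_derivative_zero_constant by metis
  then show ?thesis
    using assms(4,5) by simp
qed

lemma motion_derivatives:
  assumes "twice_differentiable_motion T f" "t \<in> T"
  shows "(f has_vector_derivative velocity f t) (at t)"
    and "(velocity f has_vector_derivative acceleration f t) (at t)"
  using assms unfolding twice_differentiable_motion_def by (auto simp: vector_derivative_works)

lemma rigid_rod_velocity:
  assumes "open T" "t \<in> T"
    and "twice_differentiable_motion T f" "twice_differentiable_motion T g"
    and "\<And>s. s \<in> T \<Longrightarrow> norm (f s - g s) = l"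
  shows "(f t - g t) \<bullet> (velocity f t - velocity g t) = 0"
proof -
  have d: "((\<lambda>s. f s - g s) has_vector_derivative (velocity f t - velocity g t)) (at t)"
    using assms by (intro has_vector_derivative_diff motion_derivatives)
  have "(f t - g t) \<bullet> (velocity f t - velocity g t) + (velocity f t - velocity g t) \<bullet> (f t - g t) = 0"
    by (rule vector_derivative_const_on_open[OF has_vector_derivative_inner[OF d d] assms(1,2),
          where c = "l\<^sup>2"])
      (use assms(5) in \<open>simp add: dot_square_norm\<close>)
  then show ?thesis
    by (simp add: inner_commute)
qed

lemma center_of_mass_velocity:
  assumes "open T" "t \<in> T"
    and "twice_differentiable_motion T x" "twice_differentiable_motion T y"
      "twice_differentiable_motion T z"
    and "center_of_mass_frame T mx my mz x y z"
  shows "mx *\<^sub>R velocity x t + my *\<^sub>R velocity y t + mz *\<^sub>R velocity z t = 0"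
proof -
  have "((\<lambda>s. mx *\<^sub>R x s + my *\<^sub>R y s + mz *\<^sub>R z s) has_vector_derivative
      (mx *\<^sub>R velocity x t + my *\<^sub>R velocity y t + mz *\<^sub>R velocity z t)) (at t)"
    by (intro has_vector_derivative_add has_vector_derivative_scaleR_right
        motion_derivatives(1)[OF _ assms(2)] assms)
  then show ?thesis
    by (rule vector_derivative_const_on_open[OF _ assms(1,2), where c = 0])
      (use assms(6) in \<open>simp add: center_of_mass_frame_def\<close>)
qed

text \<open>The rod forces do no work in total: their power is a combination of the products rod
  times relative velocity of its ends, and these vanish by rigidity.\<close>

lemma linkage_kinetic_energy_constant:
  assumes T: "open T" "is_interval T"
    and link: "free_double_linkage T mx my mz l1 l2 x y z"
    and t: "t0 \<in> T" "t \<in> T"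
  shows "kinetic_energy mx my mz x y z t = kinetic_energy mx my mz x y z t0"
proof (rule constant_on_open_interval[OF T _ t])
  fix s assume s: "s \<in> T"
  let ?v = "\<lambda>f. velocity f s" and ?a = "\<lambda>f. acceleration f s"
  from link obtain F1 F2 where
    mot: "twice_differentiable_motion T x" "twice_differentiable_motion T y"
      "twice_differentiable_motion T z"
    and rods: "\<And>s. s \<in> T \<Longrightarrow> norm (x s - y s) = l1" "\<And>s. s \<in> T \<Longrightarrow> norm (z s - y s) = l2"
    and eqs: "mx *\<^sub>R ?a x = F1 s *\<^sub>R (y s - x s)"
      "my *\<^sub>R ?a y = - F1 s *\<^sub>R (y s - x s) + F2 s *\<^sub>R (z s - y s)"
      "mz *\<^sub>R ?a z = - F2 s *\<^sub>R (z s - y s)"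
    unfolding free_double_linkage_def using s by meson
  have c1: "(x s - y s) \<bullet> (?v x - ?v y) = 0"
    by (rule rigid_rod_velocity[OF T(1) s mot(1,2) rods(1)])
  have c2: "(z s - y s) \<bullet> (?v z - ?v y) = 0"
    by (rule rigid_rod_velocity[OF T(1) s mot(3,2) rods(2)])
  have sq: "((\<lambda>s. (norm (velocity f s))\<^sup>2) has_vector_derivative 2 * (?v f \<bullet> ?a f)) (at s)"
    if "twice_differentiable_motion T f" for f
    using has_vector_derivative_inner[OF motion_derivatives(2)[OF that s] motion_derivatives(2)[OF that s]]
    by (simp add: dot_square_norm inner_commute)
  have deriv: "((\<lambda>s. (mx * (norm (velocity x s))\<^sup>2 + my * (norm (velocity y s))\<^sup>2
        + mz * (norm (velocity z s))\<^sup>2) / 2) has_vector_derivative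
      (mx * (2 * (?v x \<bullet> ?a x)) + my * (2 * (?v y \<bullet> ?a y)) + mz * (2 * (?v z \<bullet> ?a z))) / 2) (at s)"
    by (intro has_vector_derivative_divide has_vector_derivative_add
        has_vector_derivative_mult_right sq mot)
  have "mx * (?v x \<bullet> ?a x) + my * (?v y \<bullet> ?a y) + mz * (?v z \<bullet> ?a z)
      = - F1 s * ((x s - y s) \<bullet> (?v x - ?v y)) - F2 s * ((z s - y s) \<bullet> (?v z - ?v y))"
  proof -
    have "mx * (?v x \<bullet> ?a x) + my * (?v y \<bullet> ?a y) + mz * (?v z \<bullet> ?a z)
        = ?v x \<bullet> (mx *\<^sub>R ?a x) + ?v y \<bullet> (my *\<^sub>R ?a y) + ?v z \<bullet> (mz *\<^sub>R ?a z)"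
      by simp
    then show ?thesis
      unfolding eqs by (simp add: inner_diff_left inner_diff_right inner_add_right algebra_simps inner_commute)
  qed
  then have "(mx * (2 * (?v x \<bullet> ?a x)) + my * (2 * (?v y \<bullet> ?a y)) + mz * (2 * (?v z \<bullet> ?a z))) / 2 = 0"
    unfolding c1 c2 by argo
  with deriv show "(kinetic_energy mx my mz x y z has_vector_derivative 0) (at s)"
    unfolding kinetic_energy_def[abs_def] by (simp only:)
qed

text \<open>The internal forces come in opposite pairs directed along the rods, so their torques
  cancel rod by rod.\<close>

lemma linkage_angular_momentum_constant:
  assumes T: "open T" "is_interval T"
    and link: "free_double_linkage T mx my mz l1 l2 x y z"
    and t: "t0 \<in> T" "t \<in> T"
  shows "angular_momentum mx my mz x y z t = angular_momentum mx my mz x y z t0"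
proof (rule constant_on_open_interval[OF T _ t])
  fix s assume s: "s \<in> T"
  let ?a = "\<lambda>f. acceleration f s"
  from link obtain F1 F2 where
    mot: "twice_differentiable_motion T x" "twice_differentiable_motion T y"
      "twice_differentiable_motion T z"
    and eqs: "mx *\<^sub>R ?a x = F1 s *\<^sub>R (y s - x s)"
      "my *\<^sub>R ?a y = - F1 s *\<^sub>R (y s - x s) + F2 s *\<^sub>R (z s - y s)"
      "mz *\<^sub>R ?a z = - F2 s *\<^sub>R (z s - y s)"
    unfolding free_double_linkage_def using s by meson
  have cr: "((\<lambda>s. cross3 (f s) (velocity f s)) has_vector_derivative cross3 (f s) (?a f)) (at s)"
    if "twice_differentiable_motion T f" for f
    using has_vector_derivative_cross3[OF motion_derivatives[OF that s]] by simp
  have "((\<lambda>s. mx *\<^sub>R cross3 (x s) (velocity x s) + my *\<^sub>R cross3 (y s) (velocity y s)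
        + mz *\<^sub>R cross3 (z s) (velocity z s)) has_vector_derivative
      (mx *\<^sub>R cross3 (x s) (?a x) + my *\<^sub>R cross3 (y s) (?a y) + mz *\<^sub>R cross3 (z s) (?a z))) (at s)"
    by (intro has_vector_derivative_add has_vector_derivative_scaleR_right
        cr mot)
  moreover have "mx *\<^sub>R cross3 (x s) (?a x) + my *\<^sub>R cross3 (y s) (?a y) + mz *\<^sub>R cross3 (z s) (?a z) = 0"
  proof -
    have "mx *\<^sub>R cross3 (x s) (?a x) + my *\<^sub>R cross3 (y s) (?a y) + mz *\<^sub>R cross3 (z s) (?a z)
        = cross3 (x s) (mx *\<^sub>R ?a x) + cross3 (y s) (my *\<^sub>R ?a y) + cross3 (z s) (mz *\<^sub>R ?a z)"
      by (simp add: cross_mult_right)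
    also have "\<dots> = 0"
      unfolding eqs
      by (simp add: cross_add_right cross_mult_right Cross3.right_diff_distrib algebra_simps
          cross_skew[of "y s" "x s"] cross_skew[of "z s" "y s"])
    finally show ?thesis .
  qed
  ultimately show "(angular_momentum mx my mz x y z has_vector_derivative 0) (at s)"
    unfolding angular_momentum_def[abs_def] by simp
qed

section \<open>The linkage in terms of the two rods\<close>

text \<open>Lagrange's identity for a center of mass at the origin: it replaces positions by
  differences, hence by rod vectors. For a general \<open>B\<close> it covers the kinetic energy
  (inner product) and the angular momentum (oriented area) at once.\<close>

lemma barycentric_bilinear:
  fixes B :: "'a::real_normed_vector \<Rightarrow> 'b::real_normed_vector \<Rightarrow> real"
  assumes B: "bounded_bilinear B"
    and cm: "mx *\<^sub>R x + my *\<^sub>R y + mz *\<^sub>R z = 0"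
  shows "(mx + my + mz) * (mx * B x x' + my * B y y' + mz * B z z')
    = mx * my * B (x - y) (x' - y') + my * mz * B (z - y) (z' - y') + mx * mz * B (x - z) (x' - z')"
proof -
  interpret bounded_bilinear B by (rule B)
  \<comment> \<open>Subtracting this vanishing double sum from the left-hand side of the claim
    leaves exactly the three pairwise terms.\<close>
  have "B (mx *\<^sub>R x + my *\<^sub>R y + mz *\<^sub>R z) (mx *\<^sub>R x' + my *\<^sub>R y' + mz *\<^sub>R z') = 0"
    unfolding cm by (rule zero_left)
  then have "mx * (mx * B x x' + my * B x y' + mz * B x z')
      + my * (mx * B y x' + my * B y y' + mz * B y z')
      + mz * (mx * B z x' + my * B z y' + mz * B z z') = 0"
    by (simp add: add_left add_right scaleR_left scaleR_right algebra_simps)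
  then show ?thesis
    unfolding diff_left diff_right by algebra
qed

text \<open>The center of mass condition expresses everything by the rod vectors: \<open>c\<close>
  is their inner product, \<open>d\<close> their oriented area, \<open>\<omega>1\<close> and
  \<open>\<omega>2\<close> their angular velocities. Factors \<open>M\<close> and
  \<open>M\<^sup>2\<close> keep the relations polynomial.\<close>

lemma planar_linkage_parameters:
  fixes n x y z x' y' z' :: "real^3"
  assumes n: "norm n = 1" "n \<bullet> x = 0" "n \<bullet> y = 0" "n \<bullet> z = 0"
      "n \<bullet> x' = 0" "n \<bullet> y' = 0" "n \<bullet> z' = 0"
    and cm: "mx *\<^sub>R x + my *\<^sub>R y + mz *\<^sub>R z = 0" "mx *\<^sub>R x' + my *\<^sub>R y' + mz *\<^sub>R z' = 0"
    and rods: "norm (x - y) = l1" "norm (z - y) = l2" "l1 > 0" "l2 > 0"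
    and rods': "(x - y) \<bullet> (x' - y') = 0" "(z - y) \<bullet> (z' - y') = 0"
    and M: "M = mx + my + mz" "mtz = mz + my"
  obtains c d \<omega>1 \<omega>2 where
    "d\<^sup>2 = l1\<^sup>2 * l2\<^sup>2 - c\<^sup>2"
    "M\<^sup>2 * (x \<bullet> x) = mtz\<^sup>2 * l1\<^sup>2 + mz\<^sup>2 * l2\<^sup>2 - 2 * mtz * mz * c"
    "M\<^sup>2 * (x \<bullet> x') = mtz * mz * d * (\<omega>2 - \<omega>1)"
    "M\<^sup>2 * (cross3 n x \<bullet> x') = mtz\<^sup>2 * \<omega>1 * l1\<^sup>2 + mz\<^sup>2 * \<omega>2 * l2\<^sup>2 - mz * mtz * c * (\<omega>1 + \<omega>2)"
    "M\<^sup>2 * (cross3 n x \<bullet> z) = M * my * d"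
    "M * (mx * (cross3 n x \<bullet> x') + my * (cross3 n y \<bullet> y') + mz * (cross3 n z \<bullet> z'))
      = mx * mtz * l1\<^sup>2 * \<omega>1 + mz * (mx + my) * l2\<^sup>2 * \<omega>2 - mx * mz * c * (\<omega>1 + \<omega>2)"
    "M * (mx * (x' \<bullet> x') + my * (y' \<bullet> y') + mz * (z' \<bullet> z'))
      = mx * mtz * l1\<^sup>2 * \<omega>1\<^sup>2 + mz * (mx + my) * l2\<^sup>2 * \<omega>2\<^sup>2 - 2 * mx * mz * c * \<omega>1 * \<omega>2"
proof -
  define q1 q2 where "q1 = x - y" and "q2 = z - y"
  \<comment> \<open>\<open>J\<close> is the quarter turn of the plane: an isometry there, and skew.
    This yields the whole table \<open>tab\<close> of inner products of the rods and their
    turns.\<close>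
  define J where "J = cross3 n"
  interpret J: bounded_linear J
    unfolding J_def by (rule bounded_bilinear.bounded_linear_right[OF bounded_bilinear_cross3])
  define c d where "c = q1 \<bullet> q2" and "d = J q1 \<bullet> q2"
  have nq: "n \<bullet> q1 = 0" "n \<bullet> q2 = 0" "q1 \<noteq> 0" "q2 \<noteq> 0"
    using n rods by (auto simp: q1_def q2_def inner_diff_right)
  obtain \<omega>1 where \<omega>1: "x' - y' = \<omega>1 *\<^sub>R J q1"
    using plane_orthogonal_eq_cross3[of n q1 "x' - y'"] n nq rods' unfolding J_def q1_def
    by (metis diff_zero inner_diff_right)
  obtain \<omega>2 where \<omega>2: "z' - y' = \<omega>2 *\<^sub>R J q2"
    using plane_orthogonal_eq_cross3[of n q2 "z' - y'"] n nq rods' unfolding J_def q2_def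
    by (metis diff_zero inner_diff_right)
  have "n \<bullet> n = 1"
    using n(1) by (simp add: norm_eq_1)
  then have JJ: "J u \<bullet> J v = u \<bullet> v" if "n \<bullet> u = 0" for u v
    using that by (simp add: J_def inner_cross3_cross3 inner_commute)
  have Jswap: "u \<bullet> J v = - (J u \<bullet> v)" for u v
    unfolding J_def by (rule inner_cross3_swap)
  have Jself: "J u \<bullet> u = 0" for u
    unfolding J_def by (rule dot_cross_self)
  have qq: "q1 \<bullet> q1 = l1\<^sup>2" "q2 \<bullet> q2 = l2\<^sup>2"
    using rods(1,2) by (simp_all add: q1_def q2_def dot_square_norm)
  have tab: "q1 \<bullet> q1 = l1\<^sup>2" "q2 \<bullet> q2 = l2\<^sup>2" "q1 \<bullet> q2 = c" "q2 \<bullet> q1 = c"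
    "J q1 \<bullet> q2 = d" "J q2 \<bullet> q1 = - d" "q1 \<bullet> J q2 = - d" "q2 \<bullet> J q1 = d"
    "J q1 \<bullet> q1 = 0" "J q2 \<bullet> q2 = 0" "q1 \<bullet> J q1 = 0" "q2 \<bullet> J q2 = 0"
    "J q1 \<bullet> J q1 = l1\<^sup>2" "J q2 \<bullet> J q2 = l2\<^sup>2" "J q1 \<bullet> J q2 = c" "J q2 \<bullet> J q1 = c"
    using nq(1,2) JJ Jself Jswap[of q1 q2] Jswap[of q2 q1]
    by (simp_all add: c_def d_def qq inner_commute)
  have d2: "d\<^sup>2 = l1\<^sup>2 * l2\<^sup>2 - c\<^sup>2"
  proof -
    have "cross3 q1 q2 = d *\<^sub>R n"
      unfolding d_def J_def by (rule cross3_plane[OF n(1) nq(1,2)])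
    then have "cross3 q1 q2 \<bullet> cross3 q1 q2 = d\<^sup>2"
      using \<open>n \<bullet> n = 1\<close> by (simp add: power2_eq_square)
    then show ?thesis
      by (simp add: inner_cross3_cross3 tab power2_eq_square)
  qed
  have Mx: "M *\<^sub>R x = mtz *\<^sub>R q1 - mz *\<^sub>R q2"
    using cm(1) unfolding M q1_def q2_def by (simp add: algebra_simps add_eq_0_iff)
  have Mx': "M *\<^sub>R x' = (mtz * \<omega>1) *\<^sub>R J q1 - (mz * \<omega>2) *\<^sub>R J q2"
  proof -
    have "M *\<^sub>R x' = mtz *\<^sub>R (x' - y') - mz *\<^sub>R (z' - y')"
      using cm(2) unfolding M by (simp add: algebra_simps add_eq_0_iff)
    then show ?thesis
      unfolding \<omega>1 \<omega>2 by simp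
  qed
  have Mz: "M *\<^sub>R z = (mx + my) *\<^sub>R q2 - mx *\<^sub>R q1"
    using cm(1) unfolding M q1_def q2_def by (simp add: algebra_simps add_eq_0_iff)
  have MJx: "M *\<^sub>R J x = mtz *\<^sub>R J q1 - mz *\<^sub>R J q2"
    using arg_cong[OF Mx, of J] by (simp add: J.diff J.scaleR)
  have M2: "M\<^sup>2 * (u \<bullet> v) = (M *\<^sub>R u) \<bullet> (M *\<^sub>R v)" for u v :: "real^3"
    by (simp add: power2_eq_square)
  have xz: "x - z = q1 - q2" "x' - z' = \<omega>1 *\<^sub>R J q1 - \<omega>2 *\<^sub>R J q2"
    unfolding \<omega>1[symmetric] \<omega>2[symmetric] by (simp_all add: q1_def q2_def)
  \<comment> \<open>The form \<open>J u \<bullet> v\<close> is the component of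
    \<open>cross3 u v\<close> along \<open>n\<close>, so the barycentric identity applies to the
    angular momentum too.\<close>
  have BJ: "bounded_bilinear (\<lambda>u v. J u \<bullet> v)"
    by (rule bounded_bilinear.comp1[OF bounded_bilinear_inner J.bounded_linear_axioms])
  show thesis
  proof
    show "d\<^sup>2 = l1\<^sup>2 * l2\<^sup>2 - c\<^sup>2" by (rule d2)
    show "M\<^sup>2 * (x \<bullet> x) = mtz\<^sup>2 * l1\<^sup>2 + mz\<^sup>2 * l2\<^sup>2 - 2 * mtz * mz * c"
      unfolding M2 Mx by (simp add: inner_diff_left inner_diff_right tab) algebra
    show "M\<^sup>2 * (x \<bullet> x') = mtz * mz * d * (\<omega>2 - \<omega>1)"
      unfolding M2 Mx Mx' by (simp add: inner_diff_left inner_diff_right tab) algebra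
    show "M\<^sup>2 * (cross3 n x \<bullet> x') = mtz\<^sup>2 * \<omega>1 * l1\<^sup>2 + mz\<^sup>2 * \<omega>2 * l2\<^sup>2 - mz * mtz * c * (\<omega>1 + \<omega>2)"
      unfolding J_def[symmetric] M2 MJx Mx'
      by (simp add: inner_diff_left inner_diff_right tab) algebra
    show "M\<^sup>2 * (cross3 n x \<bullet> z) = M * my * d"
      unfolding J_def[symmetric] M2 MJx Mz
      by (simp add: inner_diff_left inner_diff_right tab M) algebra
    show "M * (mx * (cross3 n x \<bullet> x') + my * (cross3 n y \<bullet> y') + mz * (cross3 n z \<bullet> z'))
      = mx * mtz * l1\<^sup>2 * \<omega>1 + mz * (mx + my) * l2\<^sup>2 * \<omega>2 - mx * mz * c * (\<omega>1 + \<omega>2)"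
      unfolding J_def[symmetric] M(1) barycentric_bilinear[OF BJ cm(1)] \<omega>1 \<omega>2 xz
        q1_def[symmetric] q2_def[symmetric]
      by (simp add: inner_diff_left inner_diff_right J.diff tab M) algebra
    show "M * (mx * (x' \<bullet> x') + my * (y' \<bullet> y') + mz * (z' \<bullet> z'))
      = mx * mtz * l1\<^sup>2 * \<omega>1\<^sup>2 + mz * (mx + my) * l2\<^sup>2 * \<omega>2\<^sup>2 - 2 * mx * mz * c * \<omega>1 * \<omega>2"
      unfolding M(1) barycentric_bilinear[OF bounded_bilinear_inner cm(2)] \<omega>1 \<omega>2 xz
      by (simp add: inner_diff_left inner_diff_right tab M) algebra
  qed
qed

section \<open>The pedal equation\<close>

text \<open>Write \<open>A\<close> for the moment of inertia and \<open>s = x \<bullet> x'\<close>. With \<open>e\<close> the angular momentum,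
  \<open>A * w * h + L2 * u\<^sup>2 * s = w * e * u\<close> replaces the second factor of the pedal equation by
  \<open>w * e / (u * s)\<close>; what remains is the discriminant identity of the kinetic energy as a
  quadratic form in the two angular velocities.\<close>

lemma linkage_pedal_scalar:
  fixes mx my mz l1 l2 c d \<omega>1 \<omega>2 u s h w e K :: real
  assumes pos: "mx > 0" "my > 0" "mz > 0" and us: "u \<noteq> 0" "s \<noteq> 0"
    and M: "M = mx + my + mz" and mtz: "mtz = mz + my"
    and r1: "r1 = (l1 * mtz + l2 * mz) / M"
    and r0: "r0 = (l1 * mtz - l2 * mz) / M"
    and a: "a = M * my * (r1 - r0)\<^sup>2"
    and b: "b = 4 * mx * mz"
    and L1: "L1 = M / (4 * mtz * mz) * (b + a / u)"
    and L2: "L2 = a * M\<^sup>2 * my / (8 * mz\<^sup>2 * mtz\<^sup>2 * u) * (1 + r0 * r1 / u)"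
    and P2: "P2 = 4 * (mx\<^sup>2 * M\<^sup>2 / mtz\<^sup>2) * (w / u)\<^sup>2
                 + my^3 * mx * M^5 / (4 * mz^3 * mtz^4) * ((r1\<^sup>2 - r0\<^sup>2)\<^sup>2 / u\<^sup>2)"
    and d: "d\<^sup>2 = l1\<^sup>2 * l2\<^sup>2 - c\<^sup>2"
    and u: "M\<^sup>2 * u = mtz\<^sup>2 * l1\<^sup>2 + mz\<^sup>2 * l2\<^sup>2 - 2 * mtz * mz * c"
    and s: "M\<^sup>2 * s = mtz * mz * d * (\<omega>2 - \<omega>1)"
    and h: "M\<^sup>2 * h = mtz\<^sup>2 * \<omega>1 * l1\<^sup>2 + mz\<^sup>2 * \<omega>2 * l2\<^sup>2 - mz * mtz * c * (\<omega>1 + \<omega>2)"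
    and w: "M\<^sup>2 * w = M * my * d"
    and e: "M * e = mx * mtz * l1\<^sup>2 * \<omega>1 + mz * (mx + my) * l2\<^sup>2 * \<omega>2 - mx * mz * c * (\<omega>1 + \<omega>2)"
    and K: "M * (2 * K) = mx * mtz * l1\<^sup>2 * \<omega>1\<^sup>2 + mz * (mx + my) * l2\<^sup>2 * \<omega>2\<^sup>2 - 2 * mx * mz * c * \<omega>1 * \<omega>2"
  shows "(my * M / (2 * mz * mtz))\<^sup>2 * ((r1\<^sup>2 - u) * (u - r0\<^sup>2)) = w\<^sup>2"
    and "(e\<^sup>2 - 2 * L1 * K * u) * (L1 * (w * h / (u * s)) + L2)\<^sup>2 + e\<^sup>2 * (P2 / 4) = 0"
proof -
  have nz: "M > 0" "mtz > 0" "M \<noteq> 0" "mtz \<noteq> 0" "mx \<noteq> 0" "my \<noteq> 0" "mz \<noteq> 0"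
    using pos by (auto simp: M mtz)
  have w1: "M * w = my * d"
    using w nz by (simp add: power2_eq_square)
  have R1: "M * r1 = l1 * mtz + l2 * mz" and R0: "M * r0 = l1 * mtz - l2 * mz"
    using nz by (simp_all add: r1 r0)
  \<comment> \<open>Here \<open>u\<close> is \<open>r\<^sup>2\<close>. The rods are stretched out at
    \<open>c = - l1 * l2\<close>, where \<open>u = r1\<^sup>2\<close>, and folded at
    \<open>c = l1 * l2\<close>, where \<open>u = r0\<^sup>2\<close>. The product of the two factors
    in \<open>c\<close> is \<open>d\<^sup>2\<close>.\<close>
  have ru: "M\<^sup>2 * (r1\<^sup>2 - u) = 2 * mtz * mz * (l1 * l2 + c)" "M\<^sup>2 * (u - r0\<^sup>2) = 2 * mtz * mz * (l1 * l2 - c)"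
    using R1 R0 u by algebra+
  have "(my * M)\<^sup>2 * ((M\<^sup>2 * (r1\<^sup>2 - u)) * (M\<^sup>2 * (u - r0\<^sup>2))) = M^4 * (w\<^sup>2 * (2 * mz * mtz)\<^sup>2)"
    unfolding ru using w1 d by algebra
  then have "M^4 * ((my * M)\<^sup>2 * ((r1\<^sup>2 - u) * (u - r0\<^sup>2))) = M^4 * (w\<^sup>2 * (2 * mz * mtz)\<^sup>2)"
    by algebra
  then have "(my * M)\<^sup>2 * ((r1\<^sup>2 - u) * (u - r0\<^sup>2)) = w\<^sup>2 * (2 * mz * mtz)\<^sup>2"
    using nz by simp
  then show "(my * M / (2 * mz * mtz))\<^sup>2 * ((r1\<^sup>2 - u) * (u - r0\<^sup>2)) = w\<^sup>2"
    using nz by (simp add: power_divide divide_simps)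

  \<comment> \<open>\<open>M * (2 * K)\<close> is the quadratic form with diagonal
    \<open>I1\<close>, \<open>I2\<close> and off-diagonal entry \<open>- J\<close>; its determinant
    is \<open>mx * mz * G\<close>. Its value at \<open>(1, 1)\<close> is \<open>M * A\<close>, and
    its polar form at \<open>(1, 1)\<close> and the angular velocities is
    \<open>M * e\<close>.\<close>
  define I1 I2 J G where "I1 = mx * mtz * l1\<^sup>2" and "I2 = mz * (mx + my) * l2\<^sup>2"
    and "J = mx * mz * c" and "G = mx * mz * d\<^sup>2 + my * M * (l1\<^sup>2 * l2\<^sup>2)"
  define A where "A = L1 * u"
  have r10: "r1 - r0 = 2 * l2 * mz / M" "r1\<^sup>2 - r0\<^sup>2 = 4 * l1 * l2 * mtz * mz / M\<^sup>2"
    unfolding r1 r0 using nz by (simp_all add: field_simps power2_eq_square)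
  have a': "a = 4 * my * mz\<^sup>2 * l2\<^sup>2 / M"
    unfolding a r10 using nz by (simp add: field_simps power2_eq_square)
  have "mtz * A = mx * M * u + my * mz * l2\<^sup>2"
    unfolding A_def L1 a' b using nz us by (simp add: field_simps power2_eq_square)
  then have "mtz * (M * A) = mx * (M\<^sup>2 * u) + my * mz * M * l2\<^sup>2"
    by algebra
  also have "\<dots> = mtz * (I1 + I2 - 2 * J)"
    unfolding u unfolding I1_def I2_def J_def M mtz by algebra
  finally have A: "M * A = I1 + I2 - 2 * J"
    using nz by simp

  have "2 * mtz\<^sup>2 * (L2 * u\<^sup>2) = my\<^sup>2 * l2\<^sup>2 * M * (u + r0 * r1)"
    unfolding L2 a' using nz us by (simp add: field_simps power2_eq_square)
  moreover have "M\<^sup>2 * (u + r0 * r1) = 2 * mtz * (mtz * l1\<^sup>2 - mz * c)"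
    using R1 R0 u by algebra
  ultimately have "(2 * mtz * M) * (mtz * M * (L2 * u\<^sup>2)) = (2 * mtz * M) * (my\<^sup>2 * l2\<^sup>2 * (mtz * l1\<^sup>2 - mz * c))"
    by algebra
  then have L2': "mtz * M * (L2 * u\<^sup>2) = my\<^sup>2 * l2\<^sup>2 * (mtz * l1\<^sup>2 - mz * c)"
    using nz by simp

  have e': "M * e = I1 * \<omega>1 + I2 * \<omega>2 - J * (\<omega>1 + \<omega>2)"
    and K': "M * (2 * K) = I1 * \<omega>1\<^sup>2 + I2 * \<omega>2\<^sup>2 - 2 * J * \<omega>1 * \<omega>2"
    unfolding e K I1_def I2_def J_def by algebra+

  \<comment> \<open>In a rigid rotation, \<open>\<omega>1 = \<omega>2\<close>, one has
    \<open>A * h = e * u\<close>. In general the difference of these linear forms is therefore a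
    multiple of \<open>\<omega>2 - \<omega>1\<close>; its coefficient is what \<open>L2\<close>
    encodes.\<close>
  have key: "(I1 + I2 - 2 * J) * (M\<^sup>2 * h) + my * M * l2\<^sup>2 * mz * (mtz * l1\<^sup>2 - mz * c) * (\<omega>2 - \<omega>1)
      = (M * e) * (M\<^sup>2 * u)"
    unfolding e' h u unfolding I1_def I2_def J_def M mtz by algebra
  \<comment> \<open>The factor \<open>w\<close>, a multiple of \<open>d\<close>, turns
    \<open>\<omega>2 - \<omega>1\<close> into a multiple of \<open>s\<close>, which makes the
    angular velocities disappear.\<close>
  have "(mtz * M ^ 4) * (A * w * h + L2 * u\<^sup>2 * s)
      = mtz * (M * A) * (M * w) * (M\<^sup>2 * h) + M * (mtz * M * (L2 * u\<^sup>2)) * (M\<^sup>2 * s)"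
    by algebra
  also have "\<dots> = mtz * my * d * ((I1 + I2 - 2 * J) * (M\<^sup>2 * h)
      + my * M * l2\<^sup>2 * mz * (mtz * l1\<^sup>2 - mz * c) * (\<omega>2 - \<omega>1))"
    unfolding A w1 L2' s by algebra
  also have "\<dots> = mtz * (M * w) * ((M * e) * (M\<^sup>2 * u))"
    unfolding key w1 by algebra
  also have "\<dots> = (mtz * M ^ 4) * (w * e * u)"
    by algebra
  finally have lin: "A * w * h + L2 * u\<^sup>2 * s = w * e * u"
    using nz by simp

  \<comment> \<open>Gram identity of the quadratic form at \<open>(1, 1)\<close> and
    \<open>(\<omega>1, \<omega>2)\<close>: the squared determinant of these two vectors is
    \<open>(\<omega>2 - \<omega>1)\<^sup>2\<close>.\<close>
  have "(M * e)\<^sup>2 - (M * A) * (M * (2 * K)) = - (mx * mz * G * (\<omega>2 - \<omega>1)\<^sup>2)"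
    unfolding e' A K' unfolding I1_def I2_def J_def G_def d M mtz by algebra
  then have q1: "M\<^sup>2 * (e\<^sup>2 - 2 * A * K) = - (mx * mz * G * (\<omega>2 - \<omega>1)\<^sup>2)"
    by algebra
  \<comment> \<open>So \<open>P2 / 4\<close> is the determinant of the quadratic form in disguise;
    this fixes the factor \<open>1 / 4\<close> in the pedal equation.\<close>
  have P: "P2 * u\<^sup>2 / 4 = mx * my\<^sup>2 * G / (mz * mtz\<^sup>2)"
  proof -
    have w': "w = my * d / M"
      using w1 nz by (simp add: field_simps)
    show ?thesis
      unfolding P2 r10 w' G_def using nz us
      by (simp add: field_simps) (simp add: power2_eq_square power3_eq_cube power4_eq_xxxx power_numeral_odd power_numeral_even algebra_simps)
  qed
  have "M ^ 4 * ((e\<^sup>2 - 2 * A * K) * w\<^sup>2 + P2 * u\<^sup>2 / 4 * s\<^sup>2)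
      = (M\<^sup>2 * (e\<^sup>2 - 2 * A * K)) * (M * w)\<^sup>2 + P2 * u\<^sup>2 / 4 * (M\<^sup>2 * s)\<^sup>2"
    by algebra
  also have "\<dots> = 0"
    unfolding q1 w1 s P using nz by (simp add: field_simps power2_eq_square)
  finally have disc: "(e\<^sup>2 - 2 * A * K) * w\<^sup>2 + P2 * u\<^sup>2 / 4 * s\<^sup>2 = 0"
    using nz by simp

  have "L1 * (w * h / (u * s)) + L2 = (A * w * h + L2 * u\<^sup>2 * s) / (u\<^sup>2 * s)"
    unfolding A_def using us by (simp add: field_simps power2_eq_square)
  also have "\<dots> = w * e / (u * s)"
    unfolding lin using us by (simp add: field_simps power2_eq_square)
  finally have fac: "L1 * (w * h / (u * s)) + L2 = w * e / (u * s)" .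
  have "(e\<^sup>2 - 2 * L1 * K * u) * (w * e / (u * s))\<^sup>2 + e\<^sup>2 * (P2 / 4)
      = e\<^sup>2 * ((e\<^sup>2 - 2 * A * K) * w\<^sup>2 + P2 * u\<^sup>2 / 4 * s\<^sup>2) / (u * s)\<^sup>2"
    unfolding A_def using us by (simp add: field_simps power2_eq_square)
  then show "(e\<^sup>2 - 2 * L1 * K * u) * (L1 * (w * h / (u * s)) + L2)\<^sup>2 + e\<^sup>2 * (P2 / 4) = 0"
    unfolding fac disc by simp
qed

text \<open>The sign \<open>\<sigma>\<close> restores what the square root in \<open>\<beta>\<close>
  loses, namely on which side of the line through the origin and \<open>x\<close> the node
  \<open>z\<close> lies. The last term is \<open>P2 / 4\<close>: as \<open>P2\<close> is positive,
  the equation with \<open>P2\<close> itself would fail whenever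
  \<open>L \<noteq> 0\<close>.\<close>

theorem theorem1:
  fixes T :: "real set"
    and mx my mz l1 l2 :: real
    and x y z :: "real \<Rightarrow> real^3"
    and K M mtz a b r0 r1 :: real
    and L :: "real^3"
    and L1 L2 P2 \<beta> :: "real \<Rightarrow> real"
    and t0 t r p pc \<sigma> :: real
  assumes "open T" and "is_interval T"
    and "free_double_linkage T mx my mz l1 l2 x y z"
    and "coplanar_motion T x y z"
    and "center_of_mass_frame T mx my mz x y z"
    and "t0 \<in> T"
    and "K = kinetic_energy mx my mz x y z t0"
    and "L = angular_momentum mx my mz x y z t0"
    and "M = mx + my + mz"
    and "mtz = mz + my"
    and "r1 = (l1 * mtz + l2 * mz) / M"
    and "r0 = (l1 * mtz - l2 * mz) / M"
    and "a = M * my * (r1 - r0)\<^sup>2"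
    and "b = 4 * mx * mz"
    and "\<beta> = (\<lambda>s. my * M / (2 * mz * mtz * s) * sqrt ((r1\<^sup>2 - s) * (s - r0\<^sup>2)))"
    and "L1 = (\<lambda>s. M / (4 * mtz * mz) * (b + a / s))"
    and "L2 = (\<lambda>s. a * M\<^sup>2 * my / (8 * mz\<^sup>2 * mtz\<^sup>2 * s) * (1 + r0 * r1 / s))"
    and "P2 = (\<lambda>s. 4 * (mx\<^sup>2 * M\<^sup>2 / mtz\<^sup>2) * (\<beta> s)\<^sup>2
                 + my^3 * mx * M^5 / (4 * mz^3 * mtz^4) * ((r1\<^sup>2 - r0\<^sup>2)\<^sup>2 / s\<^sup>2))"
    and "t \<in> T"
    and "r = pedal_r x t"
    and "p = pedal_p x t"
    and "pc = pedal_pc x t"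
    and "pc \<noteq> 0"
    and "\<sigma> = branch x z t"
  shows "((norm L)\<^sup>2 - 2 * L1 (r\<^sup>2) * K * r\<^sup>2)
           * (L1 (r\<^sup>2) * (p * (\<sigma> * \<beta> (r\<^sup>2)) / pc) + L2 (r\<^sup>2))\<^sup>2
         + (norm L)\<^sup>2 * (P2 (r\<^sup>2) / 4) = 0"
proof -
  note T = assms(1,2) and link = assms(3) and frame = assms(5) and t = \<open>t \<in> T\<close>
  let ?x = "x t" and ?y = "y t" and ?z = "z t"
  let ?x' = "velocity x t" and ?y' = "velocity y t" and ?z' = "velocity z t"
  from link have pos: "mx > 0" "my > 0" "mz > 0" "l1 > 0" "l2 > 0"
    and mot: "twice_differentiable_motion T x" "twice_differentiable_motion T y"
      "twice_differentiable_motion T z"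
    and rods: "\<And>s. s \<in> T \<Longrightarrow> norm (x s - y s) = l1" "\<And>s. s \<in> T \<Longrightarrow> norm (z s - y s) = l2"
    unfolding free_double_linkage_def by auto
  have Mpos: "M > 0" "mtz > 0"
    using pos assms(9,10) by auto
  have cm: "mx *\<^sub>R ?x + my *\<^sub>R ?y + mz *\<^sub>R ?z = 0"
    using frame t unfolding center_of_mass_frame_def by blast
  have cm': "mx *\<^sub>R ?x' + my *\<^sub>R ?y' + mz *\<^sub>R ?z' = 0"
    by (rule center_of_mass_velocity[OF T(1) t mot frame])
  have rods': "(?x - ?y) \<bullet> (?x' - ?y') = 0" "(?z - ?y) \<bullet> (?z' - ?y') = 0"
    using rigid_rod_velocity[OF T(1) t mot(1,2) rods(1)]
      rigid_rod_velocity[OF T(1) t mot(3,2) rods(2)] by simp_all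

  obtain m k where m: "m \<noteq> 0" "m \<bullet> ?x = k" "m \<bullet> ?y = k" "m \<bullet> ?z = k"
      "m \<bullet> ?x' = 0" "m \<bullet> ?y' = 0" "m \<bullet> ?z' = 0"
    using assms(4) t unfolding coplanar_motion_def by auto
  \<comment> \<open>The plane of motion contains the center of mass, hence passes through the
    origin.\<close>
  have "M * k = m \<bullet> (mx *\<^sub>R ?x + my *\<^sub>R ?y + mz *\<^sub>R ?z)"
    using m by (simp add: inner_add_right assms(9) algebra_simps)
  then have k: "k = 0"
    using Mpos by (simp add: cm)
  define n where "n = m /\<^sub>R norm m"
  have n: "norm n = 1" "n \<bullet> ?x = 0" "n \<bullet> ?y = 0" "n \<bullet> ?z = 0"
      "n \<bullet> ?x' = 0" "n \<bullet> ?y' = 0" "n \<bullet> ?z' = 0"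
    using m k by (simp_all add: n_def)

  define e where "e = mx * (cross3 n ?x \<bullet> ?x') + my * (cross3 n ?y \<bullet> ?y') + mz * (cross3 n ?z \<bullet> ?z')"
  have "L = angular_momentum mx my mz x y z t"
    using linkage_angular_momentum_constant[OF T link \<open>t0 \<in> T\<close> t] assms(8) by simp
  also have "\<dots> = e *\<^sub>R n"
    unfolding angular_momentum_def e_def
    by (simp add: cross3_plane[OF n(1,2,5)] cross3_plane[OF n(1,3,6)] cross3_plane[OF n(1,4,7)]
        scaleR_add_left)
  finally have L: "(norm L)\<^sup>2 = e\<^sup>2"
    using n(1) by simp
  have "K = kinetic_energy mx my mz x y z t"
    using linkage_kinetic_energy_constant[OF T link \<open>t0 \<in> T\<close> t] assms(7) by simp
  then have K: "mx * (?x' \<bullet> ?x') + my * (?y' \<bullet> ?y') + mz * (?z' \<bullet> ?z') = 2 * K"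
    unfolding kinetic_energy_def by (simp add: dot_square_norm)

  define h w where "h = cross3 n ?x \<bullet> ?x'" and "w = cross3 n ?x \<bullet> ?z"
  have u: "r\<^sup>2 = ?x \<bullet> ?x"
    by (simp add: assms(20) pedal_r_def dot_square_norm)
  have s: "?x \<bullet> ?x' \<noteq> 0"
    using \<open>pc \<noteq> 0\<close> by (auto simp: assms(22) pedal_pc_def)
  then have nz: "?x \<noteq> 0" "?x' \<noteq> 0" "?x \<bullet> ?x \<noteq> 0"
    by auto
  \<comment> \<open>At \<open>h = 0\<close> the convention for division by zero gives
    \<open>0\<close>, in agreement with \<open>sgn 0 = 0\<close>, so no case distinction
    arises.\<close>
  have "perp x t = (h / \<bar>h\<bar>) *\<^sub>R cross3 n ?x"
    unfolding perp_def cross3_plane[OF n(1,2,5)] h_def[symmetric] using n(1) by (simp add: cross_mult_left)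
  then have perp: "perp x t = sgn h *\<^sub>R cross3 n ?x"
    by (simp add: sgn_if)

  obtain c d \<omega>1 \<omega>2 where par: "d\<^sup>2 = l1\<^sup>2 * l2\<^sup>2 - c\<^sup>2"
    "M\<^sup>2 * (?x \<bullet> ?x) = mtz\<^sup>2 * l1\<^sup>2 + mz\<^sup>2 * l2\<^sup>2 - 2 * mtz * mz * c"
    "M\<^sup>2 * (?x \<bullet> ?x') = mtz * mz * d * (\<omega>2 - \<omega>1)"
    "M\<^sup>2 * h = mtz\<^sup>2 * \<omega>1 * l1\<^sup>2 + mz\<^sup>2 * \<omega>2 * l2\<^sup>2 - mz * mtz * c * (\<omega>1 + \<omega>2)"
    "M\<^sup>2 * w = M * my * d"
    "M * e = mx * mtz * l1\<^sup>2 * \<omega>1 + mz * (mx + my) * l2\<^sup>2 * \<omega>2 - mx * mz * c * (\<omega>1 + \<omega>2)"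
    "M * (2 * K) = mx * mtz * l1\<^sup>2 * \<omega>1\<^sup>2 + mz * (mx + my) * l2\<^sup>2 * \<omega>2\<^sup>2 - 2 * mx * mz * c * \<omega>1 * \<omega>2"
    by (rule planar_linkage_parameters[OF n cm cm' rods(1)[OF t] rods(2)[OF t] pos(4,5) rods' assms(9,10)])
      (simp only: K h_def w_def e_def)

  note pedal = linkage_pedal_scalar[OF pos(1-3) nz(3) s assms(9-14) refl refl refl par]
  \<comment> \<open>Up to sign, \<open>\<beta>\<close> is the coordinate of \<open>z\<close> along
    the quarter turn of \<open>x\<close>; the root yields its absolute value.\<close>
  have \<beta>: "\<beta> (r\<^sup>2) = \<bar>w\<bar> / (?x \<bullet> ?x)"
  proof -
    define \<kappa> where "\<kappa> = my * M / (2 * mz * mtz)"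
    have \<kappa>: "\<kappa> > 0"
      using pos Mpos by (simp add: \<kappa>_def)
    have "\<bar>w\<bar> = sqrt (\<kappa>\<^sup>2 * ((r1\<^sup>2 - r\<^sup>2) * (r\<^sup>2 - r0\<^sup>2)))"
      unfolding u \<kappa>_def pedal(1) by simp
    also have "\<dots> = \<kappa> * sqrt ((r1\<^sup>2 - r\<^sup>2) * (r\<^sup>2 - r0\<^sup>2))"
      using \<kappa> by (simp add: real_sqrt_mult)
    finally show ?thesis
      by (simp add: assms(15) u \<kappa>_def)
  qed
  then have \<beta>2: "(\<beta> (r\<^sup>2))\<^sup>2 = (w / (?x \<bullet> ?x))\<^sup>2"
    by (simp add: power_divide)
  \<comment> \<open>The speed cancels in the quotient, and \<open>perp\<close> turns
    \<open>h\<close> into its absolute value. The signs lost here and in \<open>\<beta>\<close> are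
    exactly the two factors of \<open>\<sigma>\<close>.\<close>
  have "p / pc = \<bar>h\<bar> / (?x \<bullet> ?x')"
    using nz by (simp add: assms(21,22) pedal_p_def pedal_pc_def perp h_def[symmetric] abs_sgn mult.commute)
  moreover have "\<sigma> = sgn h * sgn w"
    unfolding assms(24) branch_def perp by (simp add: inner_commute w_def sgn_mult)
  moreover have "p * (\<sigma> * \<beta> (r\<^sup>2)) / pc = (p / pc) * \<sigma> * \<beta> (r\<^sup>2)"
    by simp
  ultimately have "p * (\<sigma> * \<beta> (r\<^sup>2)) / pc = (\<bar>w\<bar> * sgn w) * (\<bar>h\<bar> * sgn h) / ((?x \<bullet> ?x) * (?x \<bullet> ?x'))"
    unfolding \<beta> by (simp add: mult_ac)
  then have ratio: "p * (\<sigma> * \<beta> (r\<^sup>2)) / pc = w * h / ((?x \<bullet> ?x) * (?x \<bullet> ?x'))"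
    by (simp only: abs_mult_sgn)
  show ?thesis
    using pedal(2) unfolding L ratio \<beta>2[symmetric] unfolding assms(16-18) u by simp
qed

end
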